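(* Let $n\ge 1$ and let $\mathcal{F}\subseteq 2^{[n]}$ be a union-closed family with $\mathcal{F}\neq\emptyset$ and $\mathcal{F}\neq\{\emptyset\}$. Then some $i\in[n]$ is contained in at least a $1-\phi^\ast$ fraction of the sets in $\mathcal{F}$, i.e. $|\{A\in\mathcal{F}: i\in A\}|\ge (1-\phi^\ast)|\mathcal{F}|$.
   Context: A family $\mathcal{F}$ of subsets of $[n]=\{1,\dots,n\}$ is union-closed if $A\cup B\in\mathcal{F}$ whenever $A,B\in\mathcal{F}$. Let $H(x)=-x\log x-(1-x)\log(1-x)$ (with $0\log 0=0$) be the entropy function. Define $S=\{\phi\in[0,1]: \phi H(x^2)\ge xH(x)\text{ for all }x\in[\phi,1]\}$ and $\phi^\ast=\min S$ (this minimum exists since $S$ is closed and the defining condition is monotone in $\phi$). *)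

theory Defs
  imports "HOL-Analysis.Analysis"
begin

definition union_closed :: "'a set set \<Rightarrow> bool" where
  "union_closed F \<longleftrightarrow> (\<forall>A\<in>F. \<forall>B\<in>F. A \<union> B \<in> F)"

text \<open>The convention \<open>0 log 0 = 0\<close> is built in, since \<open>0 * ln 0 = 0\<close>. The base of the
  logarithm is immaterial: \<open>H\<close> enters only through the homogeneous inequality below.\<close>

definition H :: "real \<Rightarrow> real" where
  "H x = - x * ln x - (1 - x) * ln (1 - x)"

definition S :: "real set" where
  "S = {\<phi>\<in>{0..1}. \<forall>x\<in>{\<phi>..1}. \<phi> * H (x\<^sup>2) \<ge> x * H x}"

definition phi_star :: real where
  "phi_star = (LEAST \<phi>. \<phi> \<in> S)"

text \<open>\<open>LEAST\<close> is meaningful only if the minimum exists; the following lemmas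
  establish this.\<close>

lemma isCont_H:
  assumes "0 < x" "x < 1"
  shows "isCont H x"
proof -
  have "isCont (\<lambda>x. - x * ln x - (1 - x) * ln (1 - x)) x"
    using assms by (intro continuous_intros) auto
  then show ?thesis
    unfolding H_def[abs_def] .
qed

lemma one_in_S: "1 \<in> S"
  by (simp add: S_def H_def)

lemma bdd_below_S: "bdd_below S"
  by (rule bdd_belowI[of _ 0]) (simp add: S_def)

lemma Inf_S_in_S: "Inf S \<in> S"
proof -
  define p where "p = Inf S"
  have p0: "0 \<le> p"
    unfolding p_def using one_in_S by (intro cInf_greatest) (auto simp: S_def)
  have p1: "p \<le> 1"
    unfolding p_def by (rule cInf_lower[OF one_in_S bdd_below_S])
  have above: "x * H x \<le> p * H (x\<^sup>2)" if x: "p < x" "x \<le> 1" for x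
  proof -
    have "p \<in> closure S"
      unfolding p_def using one_in_S bdd_below_S by (intro closure_contains_Inf) auto
    then obtain u where u: "\<And>k. u k \<in> S" "u \<longlonglongrightarrow> p"
      by (auto simp: closure_sequential)
    have "eventually (\<lambda>k. u k < x) sequentially"
      using u(2) x(1) by (rule order_tendstoD)
    then have "eventually (\<lambda>k. x * H x \<le> u k * H (x\<^sup>2)) sequentially"
    proof (rule eventually_mono)
      fix k assume "u k < x"
      then show "x * H x \<le> u k * H (x\<^sup>2)"
        using u(1)[of k] x(2) by (auto simp: S_def)
    qed
    moreover have "(\<lambda>k. u k * H (x\<^sup>2)) \<longlonglongrightarrow> p * H (x\<^sup>2)"
      by (intro tendsto_intros u(2))
    ultimately show ?thesis
      by (intro tendsto_lowerbound[where F = sequentially]) auto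
  qed
  have at_p: "p * H p \<le> p * H (p\<^sup>2)"
  proof -
    consider "p = 0" | "p = 1" | "0 < p" "p < 1"
      using p0 p1 by linarith
    then show ?thesis
    proof cases
      case 3
      have "p\<^sup>2 < 1"
        using 3 by (simp add: power_less_one_iff)
      then have "isCont H (p\<^sup>2)"
        using 3 by (intro isCont_H) auto
      moreover have "isCont (\<lambda>x::real. x\<^sup>2) p"
        by simp
      ultimately have "isCont (\<lambda>x. H (x\<^sup>2)) p"
        by (intro isCont_o2[where a = p and f = "\<lambda>x. x\<^sup>2" and g = H])
      then have "isCont (\<lambda>x. p * H (x\<^sup>2) - x * H x) p"
        using isCont_H[OF 3] by (intro isCont_diff isCont_mult) simp_all
      then have "((\<lambda>x. p * H (x\<^sup>2) - x * H x) \<longlongrightarrow> p * H (p\<^sup>2) - p * H p) (at_right p)"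
        unfolding isCont_def by (rule tendsto_within_subset) simp
      moreover have "eventually (\<lambda>x. 0 \<le> p * H (x\<^sup>2) - x * H x) (at_right p)"
        unfolding eventually_at_right[OF 3(2)] using above 3(2)
        by (intro exI[of _ 1]) auto
      ultimately have "0 \<le> p * H (p\<^sup>2) - p * H p"
        by (intro tendsto_lowerbound[where F = "at_right p"]) auto
      then show ?thesis by simp
    qed (simp_all add: H_def)
  qed
  show ?thesis
    unfolding S_def mem_Collect_eq p_def[unfolded S_def, symmetric]
  proof (intro conjI ballI)
    show "p \<in> {0..1}" using p0 p1 by simp
    fix x assume "x \<in> {p..1}"
    then consider "x = p" | "p < x" "x \<le> 1" by fastforce
    then show "x * H x \<le> p * H (x\<^sup>2)"
      by cases (use at_p in simp, rule above)
  qed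
qed

lemma phi_star_eq_Inf: "phi_star = Inf S"
  unfolding phi_star_def
  by (rule Least_equality) (rule Inf_S_in_S, rule cInf_lower[OF _ bdd_below_S])

lemma phi_star_in_S: "phi_star \<in> S"
  unfolding phi_star_eq_Inf by (rule Inf_S_in_S)

lemma phi_star_le: "\<phi> \<in> S \<Longrightarrow> phi_star \<le> \<phi>"
  unfolding phi_star_eq_Inf by (rule cInf_lower[OF _ bdd_below_S])

end

theory Submission
  imports Defs
begin

text \<open>
  Let \<open>A\<close>, \<open>B\<close> be independent uniform members of \<open>F\<close>. If every element were missing from more than a
  fraction \<open>\<phi> = phi_star\<close> of the members, then exposing the elements one at a time would show that
  \<open>A \<union> B\<close> has strictly larger entropy than \<open>A\<close>: each step needs \<open>E H(p q) \<ge> E p * E H(p) / \<phi>\<close> for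
  the conditional probabilities \<open>p\<close>, \<open>q\<close> of absence, which follows from
  \<open>x H(y) + y H(x) \<le> 2 \<phi> H(x y)\<close>. But \<open>A \<union> B\<close> takes values in \<open>F\<close>, on which the uniform law has the
  largest entropy.

  The two-variable inequality reduces to the diagonal \<open>x = y\<close>, because \<open>H(x) / x\<close> is concave as a
  function of \<open>t = - ln x\<close>. On the diagonal it is the condition defining \<open>S\<close> for \<open>x \<ge> \<phi>\<close>, and it
  propagates to \<open>x < \<phi>\<close> by monotonicity in \<open>t\<close>; this last step uses that every member of \<open>S\<close> is at
  least the golden section.
\<close>

section \<open>Entropy inequalities\<close>

definition golden :: real where
  "golden = (sqrt 5 - 1) / 2"

lemma golden_pos: "0 < golden" and golden_gt: "3/5 < golden" and golden_lt: "golden < 63/100"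
  and golden_sq: "golden\<^sup>2 = 1 - golden"
proof -
  have "sqrt 5 > 11/5" "sqrt 5 < 113/50"
    using real_less_rsqrt[of "11/5" 5] real_less_lsqrt[of "113/50" 5] by (simp_all add: power2_eq_square)
  then show "0 < golden" "3/5 < golden" "golden < 63/100"
    by (auto simp: golden_def)
  show "golden\<^sup>2 = 1 - golden"
    by (simp add: golden_def power2_eq_square field_simps)
qed

lemma golden_le_iff:
  assumes "0 \<le> x"
  shows "golden \<le> x \<longleftrightarrow> 1 \<le> x + x\<^sup>2"
proof -
  have "x + x\<^sup>2 - 1 = (x - golden) * (x + golden + 1)"
    using golden_sq by (simp add: power2_eq_square algebra_simps)
  then show ?thesis
    using assms golden_pos by (smt (verit) mult_nonneg_nonneg mult_neg_pos)
qed

lemma H_0 [simp]: "H 0 = 0" and H_1 [simp]: "H 1 = 0"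
  by (simp_all add: H_def)

lemma H_sym: "H (1 - x) = H x"
  by (simp add: H_def algebra_simps)

lemma H_nonneg:
  assumes "0 \<le> x" "x \<le> 1"
  shows "0 \<le> H x"
proof (cases "x = 0 \<or> x = 1")
  case False
  then have "x * ln x \<le> 0" "(1 - x) * ln (1 - x) \<le> 0"
    using assms by (auto intro!: mult_nonneg_nonpos)
  then show ?thesis by (simp add: H_def)
qed auto

lemma H_strict_mono:
  assumes "0 < x" "x < y" "y \<le> 1/2"
  shows "H x < H y"
proof (rule DERIV_pos_imp_increasing_open[OF assms(2)])
  fix t assume t: "x < t" "t < y"
  have "0 < t" "t < 1" using t assms by auto
  then have "(H has_real_derivative - ln t - t * (1 / t) - (- ln (1 - t) + (1 - t) * (- 1 / (1 - t)))) (at t)"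
    unfolding H_def[abs_def] by (auto intro!: derivative_eq_intros)
  then have "(H has_real_derivative (ln (1 - t) - ln t)) (at t)"
    using \<open>0 < t\<close> \<open>t < 1\<close> by simp
  moreover have "ln (1 - t) - ln t > 0" using t assms by simp
  ultimately show "\<exists>d. (H has_real_derivative d) (at t) \<and> 0 < d" by blast
next
  show "continuous_on {x..y} H"
    using assms by (auto intro!: continuous_at_imp_continuous_on isCont_H)
qed

text \<open>Below \<open>golden\<close> one has \<phi> + \<phi>^2 < 1, so \<phi>^2 lies strictly
  below both \<phi> and 1 - \<phi>. Since \<open>H\<close> is symmetric about 1/2 and strictly
  increasing up to there, H (\<phi>^2) < H \<phi>, and the condition in \<open>S\<close> fails
  already at x = \<phi>.\<close>

lemma golden_le_of_mem_S:
  assumes "\<phi> \<in> S"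
  shows "golden \<le> \<phi>"
proof (rule ccontr)
  assume "\<not> golden \<le> \<phi>"
  have \<phi>: "0 \<le> \<phi>" "\<phi> \<le> 1" and le: "\<And>x. \<phi> \<le> x \<Longrightarrow> x \<le> 1 \<Longrightarrow> x * H x \<le> \<phi> * H (x\<^sup>2)"
    using assms by (auto simp: S_def)
  have lt: "\<phi> + \<phi>\<^sup>2 < 1" "\<phi> < 1"
    using \<open>\<not> golden \<le> \<phi>\<close> golden_le_iff[OF \<phi>(1)] golden_lt by auto
  show False
  proof (cases "\<phi> = 0")
    \<comment> \<open>For \<phi> = 0 the test point x = \<phi> gives no contradiction; any x with x
      * H x > 0 does.\<close>
    case True
    have "0 < H (1/2)" using H_strict_mono[of "1/4" "1/2"] H_nonneg[of "1/4"] by simp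
    then show False using le[of "1/2"] True by simp
  next
    case False
    then have pos: "0 < \<phi>" using \<phi> by simp
    have sq: "\<phi>\<^sup>2 < \<phi>" "0 < \<phi>\<^sup>2" using pos lt by (auto simp: power2_eq_square)
    have "H (\<phi>\<^sup>2) < H (min \<phi> (1 - \<phi>))"
      using pos lt sq by (intro H_strict_mono) (auto simp: min_def)
    also have "\<dots> = H \<phi>" by (simp add: min_def H_sym)
    finally have "\<phi> * H (\<phi>\<^sup>2) < \<phi> * H \<phi>" using pos by simp
    then show False using le[of \<phi>] lt by simp
  qed
qed

section \<open>Logarithmic inequalities for the slopes of H(x) / x\<close>

text \<open>Concavity of \<open>ln\<close> on the chord from 1 to 1 - v. The quotient is the
  derivative of \<open>G\<close> at t = - ln u, so this monotonicity is the concavity of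
  \<open>G\<close>.\<close>

lemma neg_ln_one_minus_div_mono:
  fixes u v :: real
  assumes "0 < u" "u \<le> v" "v < 1"
  shows "- ln (1 - u) / u \<le> - ln (1 - v) / v"
proof -
  have "(1 - u / v) * ln 1 + (u / v) * ln (1 - v) \<le> ln ((1 - u / v) *\<^sub>R 1 + (u / v) *\<^sub>R (1 - v))"
    using assms by (intro concave_onD[OF ln_concave]) auto
  also have "(1 - u / v) *\<^sub>R 1 + (u / v) *\<^sub>R (1 - v) = 1 - u"
    using assms by (simp add: field_simps)
  finally have "(u / v) * ln (1 - v) \<le> ln (1 - u)" by simp
  then show ?thesis using assms by (simp add: field_simps)
qed

text \<open>The difference \<open>M\<close> of the two sides vanishes to second order at \<open>0\<close> and vanishes at \<open>golden\<close>.
  Its second derivative has the sign of the cubic \<open>q\<close>, which changes sign once, from plus to minus: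
  so \<open>M\<close> first increases from \<open>0\<close> and is then concave down to its zero at \<open>golden\<close>.\<close>

lemma two_golden_ln_le:
  assumes u: "0 \<le> u" "u \<le> golden"
  shows "2 * golden * ln (1 + u) \<le> (2 * golden - u) * - ln (1 - u)"
proof -
  define M where "M u = (2 * golden - u) * - ln (1 - u) - 2 * golden * ln (1 + u)" for u
  define M1 where "M1 u = ln (1 - u) + (2 * golden - u) / (1 - u) - 2 * golden / (1 + u)" for u
  define M2 where "M2 u = (2 * golden - 2 + u) / (1 - u)\<^sup>2 + 2 * golden / (1 + u)\<^sup>2" for u
  define q where "q u = u ^ 3 + 4 * golden * u\<^sup>2 - 3 * u + 4 * golden - 2" for u
  define s where "s c u = u\<^sup>2 + u * c + c\<^sup>2 + 4 * golden * (u + c) - 3" for c u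
  have g: "0 < golden" "golden < 1" using golden_pos golden_lt by auto
  have M: "(M has_real_derivative M1 t) (at t)" if "0 \<le> t" "t \<le> golden" for t
    unfolding M_def[abs_def] M1_def using that g
    by (auto intro!: derivative_eq_intros simp: divide_simps) (simp add: algebra_simps)
  have M1: "(M1 has_real_derivative M2 t) (at t)" if "0 \<le> t" "t \<le> golden" for t
  proof -
    have *: "1 - t \<noteq> 0" "1 + t \<noteq> 0" "1 - t > 0" using that g by auto
    have "(M1 has_real_derivative (- 1 / (1 - t) + (- 1 * (1 - t) - (2 * golden - t) * - 1) / ((1 - t) * (1 - t))
        - (- (2 * golden) / ((1 + t) * (1 + t))))) (at t)"
      unfolding M1_def[abs_def] using * by (auto intro!: derivative_eq_intros)
    moreover have "- 1 / (1 - t) + (- 1 * (1 - t) - (2 * golden - t) * - 1) / ((1 - t) * (1 - t))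
        - (- (2 * golden) / ((1 + t) * (1 + t))) = M2 t"
      unfolding M2_def power2_eq_square using *
      by (simp add: divide_simps)
    ultimately show ?thesis by simp
  qed
  have M2: "M2 t = q t / ((1 - t)\<^sup>2 * (1 + t)\<^sup>2)" if "0 \<le> t" "t \<le> golden" for t
  proof -
    have "1 - t \<noteq> 0" "1 + t \<noteq> 0" using that g by auto
    then have "M2 t = ((2 * golden - 2 + t) * (1 + t)\<^sup>2 + 2 * golden * (1 - t)\<^sup>2) / ((1 - t)\<^sup>2 * (1 + t)\<^sup>2)"
      unfolding M2_def by (simp add: add_frac_eq)
    also have "(2 * golden - 2 + t) * (1 + t)\<^sup>2 + 2 * golden * (1 - t)\<^sup>2 = q t"
      unfolding q_def by (simp add: power2_eq_square power3_eq_cube algebra_simps)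
    finally show ?thesis .
  qed
  have "golden ^ 3 = golden * golden\<^sup>2"
    by (simp add: power3_eq_cube power2_eq_square)
  also have "\<dots> = golden - golden\<^sup>2"
    unfolding golden_sq by (simp add: right_diff_distrib golden_sq flip: power2_eq_square)
  finally have "golden ^ 3 = 2 * golden - 1" using golden_sq by simp
  moreover have "q golden = 5 * golden ^ 3 + golden - 2"
    unfolding q_def by (simp add: power2_eq_square power3_eq_cube)
  ultimately have qg: "q golden = 11 * golden - 7" by simp
  \<comment> \<open>The numerical bounds enter here: \<open>golden\<close> < 63/100 < 7/11, and q 0
    = 4 * golden - 2.\<close>
  have "q golden < 0" "0 < q 0"
    using golden_gt golden_lt qg by (simp_all add: q_def)
  moreover have "continuous_on {0..golden} q"
    unfolding q_def[abs_def] by (intro continuous_intros)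
  ultimately obtain c where c: "0 \<le> c" "c \<le> golden" "q c = 0"
    using IVT2'[of q golden 0 0] g by auto
  then have "c < golden" using \<open>q golden < 0\<close> by (cases "c = golden") auto
  have q: "q t = (t - c) * s c t" for t
  proof -
    have "q t - q c = (t - c) * s c t"
      unfolding q_def s_def by (simp add: power2_eq_square power3_eq_cube algebra_simps)
    then show ?thesis using c by simp
  qed
  have "s c golden < 0"
    using \<open>q golden < 0\<close> \<open>c < golden\<close> q[of golden] by (simp add: mult_less_0_iff)
  \<comment> \<open>\<open>s c\<close> is the quotient of \<open>q\<close> by t - c. It is largest
    at \<open>golden\<close> and negative there, so \<open>c\<close> is the only sign change of
    \<open>q\<close>.\<close>
  have s: "s c t < 0" if "0 \<le> t" "t \<le> golden" for t
  proof -
    have "t\<^sup>2 \<le> golden\<^sup>2" "t * c \<le> golden * c" "golden * (t + c) \<le> golden * (golden + c)"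
      using that c g by (auto intro!: mult_right_mono mult_left_mono power_mono)
    then have "s c t \<le> s c golden" unfolding s_def by simp
    then show ?thesis using \<open>s c golden < 0\<close> by simp
  qed
  have M2_nonneg: "0 \<le> M2 t" if "0 \<le> t" "t \<le> c" for t
    using that c s[of t] M2[of t] q[of t] by (simp add: mult_nonpos_nonpos)
  have M2_nonpos: "M2 t \<le> 0" if "c \<le> t" "t \<le> golden" for t
    using that c s[of t] M2[of t] q[of t]
    by (auto intro!: divide_nonpos_nonneg mult_nonneg_nonpos)
  have M1_nonneg: "0 \<le> M1 t" if "0 \<le> t" "t \<le> c" for t
  proof -
    have "M1 0 \<le> M1 t"
    proof (rule DERIV_nonneg_imp_nondecreasing[OF that(1)])
      fix x assume "0 \<le> x" "x \<le> t"
      then show "\<exists>y. (M1 has_real_derivative y) (at x) \<and> 0 \<le> y"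
        using that c by (intro exI[of _ "M2 x"] conjI M1 M2_nonneg) auto
    qed
    then show ?thesis by (simp add: M1_def)
  qed
  have M_nonneg: "0 \<le> M t" if "0 \<le> t" "t \<le> c" for t
  proof -
    have "M 0 \<le> M t"
    proof (rule DERIV_nonneg_imp_nondecreasing[OF that(1)])
      fix x assume "0 \<le> x" "x \<le> t"
      then show "\<exists>y. (M has_real_derivative y) (at x) \<and> 0 \<le> y"
        using that c by (intro exI[of _ "M1 x"] conjI M M1_nonneg) auto
    qed
    then show ?thesis by (simp add: M_def)
  qed
  have M_golden: "M golden = 0"
  proof -
    \<comment> \<open>With these identities both terms of \<open>M golden\<close> become multiples
      of ln golden, and they cancel.\<close>
    have "1 - golden = golden\<^sup>2" "1 + golden = 1 / golden"
      using golden_sq g by (simp_all add: field_simps power2_eq_square)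
    then show ?thesis
      unfolding M_def using g by (simp add: ln_realpow ln_div)
  qed
  have "0 \<le> M u"
  proof (cases "u \<le> c")
    case True
    then show ?thesis using M_nonneg u by simp
  next
    case False
    have "convex_on {c..golden} (\<lambda>t. - M t)"
    proof (rule f''_ge0_imp_convex)
      fix t assume "t \<in> {c..golden}"
      then show "((\<lambda>t. - M t) has_real_derivative - M1 t) (at t)"
        "((\<lambda>t. - M1 t) has_real_derivative - M2 t) (at t)" "0 \<le> - M2 t"
        using c M M1 M2_nonpos by (auto intro!: DERIV_minus)
    qed simp
    then have "- M u \<le> max (- M c) (- M golden)"
    proof -
      have "- M u \<le> (- M golden - - M c) / (golden - c) * (u - c) + - M c"
        using \<open>convex_on {c..golden} (\<lambda>t. - M t)\<close> False u by (intro convex_onD_Icc') auto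
      also have "\<dots> = M c * ((u - c) / (golden - c) - 1)"
        using M_golden \<open>c < golden\<close> by (simp add: algebra_simps)
      also have "\<dots> \<le> 0"
        using M_nonneg[of c] c \<open>c < golden\<close> u by (intro mult_nonneg_nonpos) auto
      finally show ?thesis using M_golden by simp
    qed
    then show ?thesis using M_nonneg[of c] c M_golden by simp
  qed
  then show ?thesis by (simp add: M_def)
qed

text \<open>With u = exp (- t) this says that \<phi> * G (2 * t) - G t has a nonnegative derivative.
  Up to \<open>golden\<close> it follows from \<open>two_golden_ln_le\<close>; beyond it, from (1 -
  u) * (1 + u)^2 \<le> 1.\<close>

lemma ln_one_minus_sq_le:
  fixes u :: real
  assumes "golden \<le> \<phi>" "0 \<le> u" "u \<le> \<phi>" "u < 1"
  shows "u * - ln (1 - u) \<le> 2 * \<phi> * - ln (1 - u\<^sup>2)"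
proof -
  have "1 - u\<^sup>2 = (1 - u) * (1 + u)" by (simp add: power2_eq_square algebra_simps)
  then have ln_sq: "ln (1 - u\<^sup>2) = ln (1 - u) + ln (1 + u)"
    using assms by (simp add: ln_mult)
  have "0 < 1 - u\<^sup>2" "1 - u\<^sup>2 \<le> 1"
    using assms by (simp_all add: power_less_one_iff)
  then have nn: "0 \<le> - ln (1 - u\<^sup>2)" by simp
  \<comment> \<open>The constant \<open>max u golden\<close> serves both cases, and \<phi> bounds it
    from above.\<close>
  have "u * - ln (1 - u) \<le> 2 * max u golden * - ln (1 - u\<^sup>2)"
  proof (cases "u \<le> golden")
    case True
    then show ?thesis
      using two_golden_ln_le[of u] assms unfolding ln_sq by (simp add: algebra_simps max_def)
  next
    case False
    have "(1 - u) * (1 + u)\<^sup>2 = 1 - u * (u + u\<^sup>2 - 1)"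
      by (simp add: power2_eq_square algebra_simps)
    also have "\<dots> \<le> 1" using False golden_le_iff[of u] assms by simp
    finally have "ln ((1 - u) * (1 + u)\<^sup>2) \<le> 0" using assms by simp
    then have "ln (1 - u) + 2 * ln (1 + u) \<le> 0"
      using assms by (simp add: ln_mult ln_realpow)
    then have "u * - ln (1 - u) \<le> u * (2 * - ln (1 - u\<^sup>2))"
      unfolding ln_sq using assms by (intro mult_left_mono) auto
    then show ?thesis using False by (simp add: max_def mult_ac)
  qed
  also have "\<dots> \<le> 2 * \<phi> * - ln (1 - u\<^sup>2)"
    using assms nn by (intro mult_right_mono) auto
  finally show ?thesis .
qed

section \<open>The two-variable entropy inequality\<close>

text \<open>This is H(x) / x at x = exp (- t), a coordinate in which multiplication becomes addition
  and squaring becomes doubling.\<close>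

definition G :: "real \<Rightarrow> real" where
  "G t = H (exp (- t)) / exp (- t)"

lemma G_deriv:
  assumes "0 < t"
  shows "(G has_real_derivative - ln (1 - exp (- t)) / exp (- t)) (at t)"
proof -
  have G: "G = (\<lambda>t. t - (exp t - 1) * ln (1 - exp (- t)))"
    by (simp add: G_def H_def fun_eq_iff exp_minus ln_div field_simps)
  have e: "exp (- t) < 1" using assms by simp
  have "((\<lambda>t. t - (exp t - 1) * ln (1 - exp (- t))) has_real_derivative
      1 - (exp t * ln (1 - exp (- t)) + (exp t - 1) * (exp (- t) / (1 - exp (- t))))) (at t)"
    using e by (auto intro!: derivative_eq_intros simp: field_simps)
  \<comment> \<open>This product cancels the derivative of the leading summand t, leaving only the
    logarithmic term.\<close>
  moreover have "(exp t - 1) * (exp (- t) / (1 - exp (- t))) = 1"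
    using assms by (simp add: exp_minus field_simps)
  ultimately show ?thesis unfolding G by (simp add: exp_minus field_simps)
qed

lemma G_midpoint:
  assumes "0 < s" "0 < t"
  shows "G s + G t \<le> 2 * G ((s + t) / 2)"
proof -
  have "convex_on {0<..} (\<lambda>t. - G t)"
  proof (rule convex_on_realI)
    fix x :: real assume "x \<in> {0<..}"
    then show "((\<lambda>t. - G t) has_real_derivative - (- ln (1 - exp (- x)) / exp (- x))) (at x)"
      by (intro DERIV_minus G_deriv) auto
  next
    fix x y :: real assume "x \<in> {0<..}" "y \<in> {0<..}" "x \<le> y"
    then show "- (- ln (1 - exp (- x)) / exp (- x)) \<le> - (- ln (1 - exp (- y)) / exp (- y))"
      using neg_ln_one_minus_div_mono[of "exp (- y)" "exp (- x)"] by simp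
  qed simp
  from convex_onD[OF this, of "1/2" s t] show ?thesis
    using assms by (simp add: add_divide_distrib)
qed

text \<open>For t up to - ln \<phi> this is the condition in \<open>S\<close> at x = exp (- t). From
  there on the difference of the two sides is nondecreasing by \<open>ln_one_minus_sq_le\<close>, so
  its sign at - ln \<phi> persists.\<close>

lemma G_double:
  assumes "\<phi> \<in> S" "\<phi> < 1" "0 < t"
  shows "G t \<le> \<phi> * G (2 * t)"
proof -
  have \<phi>: "golden \<le> \<phi>" "0 < \<phi>" using golden_le_of_mem_S[OF assms(1)] golden_pos by auto
  have small: "G t \<le> \<phi> * G (2 * t)" if "0 < t" "\<phi> \<le> exp (- t)" for t
  proof -
    have "exp (- t) * H (exp (- t)) \<le> \<phi> * H ((exp (- t))\<^sup>2)"
      using assms(1) that by (auto simp: S_def)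
    moreover have "exp (- (2 * t)) = (exp (- t))\<^sup>2"
      by (simp add: exp_double[symmetric])
    ultimately show ?thesis
      by (simp add: G_def power2_eq_square field_simps)
  qed
  define t0 where "t0 = - ln \<phi>"
  have t0: "0 < t0" "exp (- t0) = \<phi>" using \<phi> assms by (auto simp: t0_def)
  show ?thesis
  proof (cases "\<phi> \<le> exp (- t)")
    case True
    then show ?thesis using small assms by simp
  next
    case False
    then have "- t < - t0" using t0(2) exp_less_cancel_iff[of "- t" "- t0"] by simp
    have "\<phi> * G (2 * t0) - G t0 \<le> \<phi> * G (2 * t) - G t"
    proof (rule DERIV_nonneg_imp_nondecreasing[where f = "\<lambda>t. \<phi> * G (2 * t) - G t"])
      fix x assume x: "t0 \<le> x" "x \<le> t"
      define u where "u = exp (- x)"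
      have u: "0 < u" "u \<le> \<phi>" "u < 1"
        using x t0 assms by (auto simp: u_def simp flip: t0(2))
      have u2: "exp (- (2 * x)) = u\<^sup>2" unfolding u_def by (simp add: exp_double[symmetric])
      have "((\<lambda>x. \<phi> * G (2 * x) - G x) has_real_derivative
          \<phi> * ((- ln (1 - exp (- (2 * x))) / exp (- (2 * x))) * 2) - - ln (1 - exp (- x)) / exp (- x)) (at x)"
        using x t0 by (intro DERIV_diff DERIV_cmult DERIV_chain2[of G] G_deriv) (auto intro!: derivative_eq_intros)
      moreover have "0 \<le> \<phi> * ((- ln (1 - u\<^sup>2) / u\<^sup>2) * 2) - - ln (1 - u) / u"
        using ln_one_minus_sq_le[OF \<phi>(1), of u] u by (simp add: field_simps power2_eq_square)
      ultimately show "\<exists>y. ((\<lambda>x. \<phi> * G (2 * x) - G x) has_real_derivative y) (at x) \<and> 0 \<le> y"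
        unfolding u2 u_def[symmetric] by blast
    qed (use \<open>- t < - t0\<close> in simp)
    then show ?thesis using small[of t0] t0 by simp
  qed
qed

text \<open>In the interior, division by x * y turns the claim into G s + G t \<le> 2 * \<phi> * G
  (s + t): concavity moves to the midpoint and \<open>G_double\<close> finishes. On the boundary 1
  \<le> 2 * \<phi> suffices.\<close>

lemma H_mult_ge:
  assumes "\<phi> \<in> S" "\<phi> < 1" "0 \<le> x" "x \<le> 1" "0 \<le> y" "y \<le> 1"
  shows "x * H y + y * H x \<le> 2 * \<phi> * H (x * y)"
proof -
  have \<phi>: "1 \<le> 2 * \<phi>" using golden_le_of_mem_S[OF assms(1)] golden_gt by auto
  consider "x = 0 \<or> y = 0" | "x = 1" | "y = 1" | "0 < x" "x < 1" "0 < y" "y < 1"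
    using assms by force
  then show ?thesis
  proof cases
    case 2
    then show ?thesis using mult_right_mono[OF \<phi> H_nonneg[of y]] assms by simp
  next
    case 3
    then show ?thesis using mult_right_mono[OF \<phi> H_nonneg[of x]] assms by simp
  next
    case 4
    define s t where "s = - ln x" and "t = - ln y"
    have st: "0 < s" "0 < t" using 4 by (auto simp: s_def t_def)
    have "G s + G t \<le> 2 * G ((s + t) / 2)"
      using st by (rule G_midpoint)
    also have "\<dots> \<le> 2 * (\<phi> * G (2 * ((s + t) / 2)))"
      using st by (intro mult_left_mono G_double assms) auto
    also have "2 * ((s + t) / 2) = - ln (x * y)"
      using 4 by (simp add: ln_mult s_def t_def)
    finally have "H x / x + H y / y \<le> 2 * (\<phi> * (H (x * y) / (x * y)))"
      using 4 by (simp add: G_def s_def t_def)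
    then have "x * y * (H x / x + H y / y) \<le> x * y * (2 * (\<phi> * (H (x * y) / (x * y))))"
      using 4 by (intro mult_left_mono) auto
    then show ?thesis
      using 4 by (simp add: distrib_left mult.assoc)
  qed auto
qed

section \<open>Entropy of two-way splits without normalisation\<close>

definition xlnx :: "real \<Rightarrow> real" where
  "xlnx x = x * ln x"

lemma xlnx_0 [simp]: "xlnx 0 = 0" and xlnx_1 [simp]: "xlnx 1 = 0"
  by (simp_all add: xlnx_def)

text \<open>The left side is the tangent line of x * ln x at y. At y = 0, where \<open>ln\<close>
  takes the default value 0, the bound is claimed only for x = 0.\<close>

lemma xlnx_ge:
  assumes "0 \<le> x" "0 \<le> y" "y = 0 \<Longrightarrow> x = 0"
  shows "x * ln y + x - y \<le> xlnx x"
proof (cases "x = 0")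
  case False
  then have "0 < x" "0 < y" using assms by (auto simp: order.order_iff_strict)
  then have "x * ln (y / x) \<le> x * (y / x - 1)"
    by (intro mult_left_mono ln_le_minus_one) auto
  then show ?thesis
    using \<open>0 < x\<close> \<open>0 < y\<close> by (simp add: xlnx_def ln_div algebra_simps)
qed (use assms in simp)

text \<open>The total mass times the binary entropy of the split into \<open>a\<close> and
  \<open>b\<close>. This homogeneous form lets counts, including zero counts, be used
  directly.\<close>

definition split_gain :: "real \<Rightarrow> real \<Rightarrow> real" where
  "split_gain a b = xlnx (a + b) - xlnx a - xlnx b"

lemma split_gain_eq_H:
  assumes "0 \<le> a" "0 \<le> b"
  shows "split_gain a b = (a + b) * H (a / (a + b))"
proof (cases "a = 0 \<or> b = 0")
  case False
  then have pos: "0 < a" "0 < b" using assms by auto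
  then have "1 - a / (a + b) = b / (a + b)" by (simp add: field_simps)
  then have "(a + b) * H (a / (a + b)) = - a * ln (a / (a + b)) - b * ln (b / (a + b))"
    using pos by (simp add: H_def right_diff_distrib)
  then show ?thesis
    using pos by (simp add: split_gain_def xlnx_def ln_div algebra_simps)
qed (auto simp: split_gain_def)

lemma split_gain_nonneg: "0 \<le> a \<Longrightarrow> 0 \<le> b \<Longrightarrow> 0 \<le> split_gain a b"
  by (auto simp: split_gain_eq_H divide_simps intro!: mult_nonneg_nonneg H_nonneg)

text \<open>The right side is the tangent plane at (A, B) of a concave function homogeneous of
  degree one. It is linear in \<open>a\<close> and \<open>b\<close>, so it can be summed over many
  splits.\<close>

lemma split_gain_le:
  assumes "0 \<le> a" "0 \<le> b" "a \<le> A" "b \<le> B"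
  shows "split_gain a b \<le> a * (ln (A + B) - ln A) + b * (ln (A + B) - ln B)"
proof (cases "a = 0 \<or> b = 0")
  case True
  have "0 \<le> a * (ln (A + B) - ln A)" "0 \<le> b * (ln (A + B) - ln B)"
    using assms by (cases "a = 0"; cases "b = 0"; simp)+
  then show ?thesis using True by (auto simp: split_gain_def)
next
  case False
  then have pos: "0 < a" "0 < b" "0 < A" "0 < B" using assms by auto
  define s T where "s = a + b" and "T = A + B"
  have s: "0 < s" "0 < T" using pos by (auto simp: s_def T_def)
  \<comment> \<open>The tangent points share the mass \<open>s\<close> in the ratio A : B, so the
    non-logarithmic terms cancel in the sum.\<close>
  have "a * ln (s * (A / T)) + a - s * (A / T) \<le> xlnx a"
    using pos s by (intro xlnx_ge) auto
  moreover have "b * ln (s * (B / T)) + b - s * (B / T) \<le> xlnx b"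
    using pos s by (intro xlnx_ge) auto
  moreover have "s * (A / T) + s * (B / T) = a + b"
  proof -
    have "s * (A / T) + s * (B / T) = s * ((A + B) / T)"
      by (simp add: add_divide_distrib distrib_left)
    then show ?thesis using s by (simp add: s_def T_def)
  qed
  moreover have "ln (s * (A / T)) = ln s + ln A - ln T" "ln (s * (B / T)) = ln s + ln B - ln T"
    using pos s by (simp_all add: ln_mult_pos ln_div del: times_divide_eq_right)
  ultimately have "a * (ln s + ln A - ln T) + b * (ln s + ln B - ln T) \<le> xlnx a + xlnx b"
    by simp
  then have "s * ln s - xlnx a - xlnx b \<le> a * (ln T - ln A) + b * (ln T - ln B)"
    by (simp add: s_def algebra_simps)
  then show ?thesis by (simp add: split_gain_def xlnx_def s_def T_def)
qed

text \<open>Conditioning lowers entropy: knowing the index \<open>p\<close> can only reduce the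
  uncertainty of the split. All tangent planes are taken at the pair of totals.\<close>

lemma sum_split_gain_le:
  assumes "finite P" "\<And>p. p \<in> P \<Longrightarrow> 0 \<le> a p" "\<And>p. p \<in> P \<Longrightarrow> 0 \<le> b p"
  shows "(\<Sum>p\<in>P. split_gain (a p) (b p)) \<le> split_gain (\<Sum>p\<in>P. a p) (\<Sum>p\<in>P. b p)"
proof -
  let ?A = "\<Sum>p\<in>P. a p" and ?B = "\<Sum>p\<in>P. b p"
  have "(\<Sum>p\<in>P. split_gain (a p) (b p)) \<le>
      (\<Sum>p\<in>P. a p * (ln (?A + ?B) - ln ?A) + b p * (ln (?A + ?B) - ln ?B))"
    using assms by (intro sum_mono split_gain_le member_le_sum) auto
  also have "\<dots> = split_gain ?A ?B"
    by (simp add: sum.distrib flip: sum_distrib_right)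
      (simp add: split_gain_def xlnx_def algebra_simps)
  finally show ?thesis .
qed

text \<open>\<open>H_mult_ge\<close> at x = a / m and y = b / k, multiplied by m * k.\<close>

lemma split_gain_mult_ge:
  assumes \<phi>: "\<phi> \<in> S" "\<phi> < 1" and a: "0 \<le> a" "a \<le> m" and b: "0 \<le> b" "b \<le> k"
  shows "a * split_gain b (k - b) + b * split_gain a (m - a) \<le> 2 * \<phi> * split_gain (a * b) (m * k - a * b)"
proof -
  have ab: "a * b \<le> m * k" using a b by (intro mult_mono) auto
  show ?thesis
  proof (cases "m = 0 \<or> k = 0")
    case False
    then have pos: "0 < m" "0 < k" using a b by auto
    have "a / m * H (b / k) + b / k * H (a / m) \<le> 2 * \<phi> * H (a / m * (b / k))"
      using a b pos by (intro H_mult_ge \<phi>) auto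
    then have "m * k * (a / m * H (b / k) + b / k * H (a / m)) \<le> m * k * (2 * \<phi> * H (a / m * (b / k)))"
      using pos by (intro mult_left_mono) auto
    then show ?thesis
      using a b ab pos by (simp add: split_gain_eq_H algebra_simps)
  qed (use a b in \<open>auto simp: split_gain_def\<close>)
qed

section \<open>Exposing the elements one at a time\<close>

text \<open>If \<open>T\<close> has \<open>N\<close> elements, then \<open>ln N - fibre_sum T g I / N\<close> is the entropy of \<open>g t \<inter> I\<close> for uniform
  \<open>t \<in> T\<close>; working with counts avoids conditional probabilities and divisions by zero.\<close>

definition fibre_card :: "'b set \<Rightarrow> ('b \<Rightarrow> 'a set) \<Rightarrow> 'a set \<Rightarrow> 'a set \<Rightarrow> real" where
  "fibre_card T g I X = real (card {t \<in> T. g t \<inter> I = X})"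

definition fibre_sum :: "'b set \<Rightarrow> ('b \<Rightarrow> 'a set) \<Rightarrow> 'a set \<Rightarrow> real" where
  "fibre_sum T g I = (\<Sum>X\<in>Pow I. xlnx (fibre_card T g I X))"

lemma fibre_card_nonneg [simp]: "0 \<le> fibre_card T g I X"
  by (simp add: fibre_card_def)

lemma fibre_card_mono: "finite T \<Longrightarrow> T' \<subseteq> T \<Longrightarrow> fibre_card T' g I X \<le> fibre_card T g I X"
  unfolding fibre_card_def by (auto intro!: card_mono)

lemma fibre_card_split:
  assumes "finite T"
  shows "fibre_card T g I X = fibre_card {t \<in> T. i \<notin> g t} g I X + fibre_card {t \<in> T. i \<in> g t} g I X"
proof -
  have "{t \<in> T. g t \<inter> I = X} = {t \<in> {t \<in> T. i \<notin> g t}. g t \<inter> I = X} \<union> {t \<in> {t \<in> T. i \<in> g t}. g t \<inter> I = X}"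
    by auto
  then show ?thesis
    unfolding fibre_card_def using assms by (simp only:) (subst card_Un_disjoint; auto)
qed

lemma sum_fibre_card:
  assumes "finite T" "finite I"
  shows "(\<Sum>X\<in>Pow I. fibre_card T g I X) = real (card T)"
proof -
  have "(\<Sum>X\<in>Pow I. \<Sum>t\<in>{t \<in> T. g t \<inter> I = X}. 1::real) = (\<Sum>t\<in>T. 1)"
    using assms by (intro sum.group) auto
  then show ?thesis by (simp add: fibre_card_def)
qed

text \<open>The chain rule: both sides are card T times the conditional entropy of the event that
  \<open>i\<close> lies in \<open>g t\<close>, given the trace of \<open>g t\<close> on
  \<open>I\<close>.\<close>

lemma fibre_sum_insert:
  assumes "finite T" "finite I" "i \<notin> I"
  shows "fibre_sum T g I - fibre_sum T g (insert i I) =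
    (\<Sum>X\<in>Pow I. split_gain (fibre_card {t \<in> T. i \<notin> g t} g I X) (fibre_card {t \<in> T. i \<in> g t} g I X))"
proof -
  have out: "fibre_card T g (insert i I) X = fibre_card {t \<in> T. i \<notin> g t} g I X" if "X \<in> Pow I" for X
    unfolding fibre_card_def using that assms(3) by (intro arg_cong[of _ _ card] arg_cong[of _ _ real]) auto
  have inn: "fibre_card T g (insert i I) (insert i X) = fibre_card {t \<in> T. i \<in> g t} g I X" if "X \<in> Pow I" for X
    unfolding fibre_card_def using that assms(3) by (intro arg_cong[of _ _ card] arg_cong[of _ _ real]) auto
  have inj: "inj_on (insert i) (Pow I)"
    using assms(3) by (auto simp: inj_on_def)
  have "fibre_sum T g (insert i I) =
      (\<Sum>X\<in>Pow I. xlnx (fibre_card T g (insert i I) X)) + (\<Sum>X\<in>Pow I. xlnx (fibre_card T g (insert i I) (insert i X)))"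
    unfolding fibre_sum_def Pow_insert using assms inj
    by (subst sum.union_disjoint) (auto simp: sum.reindex)
  also have "\<dots> = (\<Sum>X\<in>Pow I. xlnx (fibre_card {t \<in> T. i \<notin> g t} g I X) + xlnx (fibre_card {t \<in> T. i \<in> g t} g I X))"
    by (simp add: out inn sum.distrib)
  finally show ?thesis
    unfolding fibre_sum_def split_gain_def fibre_card_split[OF assms(1), of g I _ i, symmetric]
    by (simp add: sum_subtractf sum.distrib)
qed

text \<open>Pairs are grouped by their two traces on \<open>I\<close>, which determine the trace of
  the union; each group is a product because the two sets are chosen independently.\<close>

lemma fibre_card_union:
  assumes "finite F" "finite I"
  shows "fibre_card (F \<times> F) (\<lambda>(A, B). A \<union> B) I Z =
    (\<Sum>p\<in>{p \<in> Pow I \<times> Pow I. fst p \<union> snd p = Z}. fibre_card F id I (fst p) * fibre_card F id I (snd p))"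
proof -
  let ?T = "{p \<in> F \<times> F. (case p of (A, B) \<Rightarrow> A \<union> B) \<inter> I = Z}"
  let ?P = "{p \<in> Pow I \<times> Pow I. fst p \<union> snd p = Z}"
  let ?g = "\<lambda>(A, B). (A \<inter> I, B \<inter> I)"
  have "real (card ?T) = (\<Sum>t\<in>?T. 1)" by simp
  also have "\<dots> = (\<Sum>p\<in>?P. \<Sum>t\<in>{t \<in> ?T. ?g t = p}. 1)"
    using assms by (intro sum.group[symmetric]) (auto simp: finite_subset[of _ "F \<times> F"] Int_Un_distrib2)
  also have "\<dots> = (\<Sum>p\<in>?P. fibre_card F id I (fst p) * fibre_card F id I (snd p))"
  proof (rule sum.cong)
    fix p assume "p \<in> ?P"
    then have "{t \<in> ?T. ?g t = p} = {A \<in> F. A \<inter> I = fst p} \<times> {A \<in> F. A \<inter> I = snd p}"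
      by (auto simp: Int_Un_distrib2)
    then show "(\<Sum>t\<in>{t \<in> ?T. ?g t = p}. 1) = fibre_card F id I (fst p) * fibre_card F id I (snd p)"
      by (simp add: fibre_card_def card_cartesian_product)
  qed simp
  finally show ?thesis by (simp add: fibre_card_def)
qed

text \<open>Replacing the trace of the union by the finer pair of traces only lowers the conditional
  entropy. For a fixed pair of traces \<open>split_gain_mult_ge\<close> applies, and the sum over
  all pairs factorises.\<close>

lemma fibre_sum_union_step:
  assumes \<phi>: "\<phi> \<in> S" "\<phi> < 1" and fin: "finite F" "finite I" and i: "i \<notin> I"
  shows "real (card {A \<in> F. i \<notin> A}) * (fibre_sum F id I - fibre_sum F id (insert i I))
    \<le> \<phi> * (fibre_sum (F \<times> F) (\<lambda>(A, B). A \<union> B) I - fibre_sum (F \<times> F) (\<lambda>(A, B). A \<union> B) (insert i I))"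
proof -
  define F0 where "F0 = {A \<in> F. i \<notin> A}"
  define m where "m = fibre_card F id I"
  define m0 where "m0 = fibre_card F0 id I"
  let ?U = "\<lambda>(A, B). A \<union> B"
  let ?W = "fibre_sum F id I - fibre_sum F id (insert i I)"
  let ?V = "fibre_sum (F \<times> F) ?U I - fibre_sum (F \<times> F) ?U (insert i I)"
  let ?P = "\<lambda>Z. {p \<in> Pow I \<times> Pow I. fst p \<union> snd p = Z}"
  have F0: "finite F0" "F0 \<subseteq> F" "finite (F \<times> F)" using fin by (auto simp: F0_def)
  have m: "0 \<le> m0 X" "m0 X \<le> m X" for X
    using fibre_card_mono[OF fin(1) F0(2)] by (auto simp: m0_def m_def)
  have mm: "m0 X * m0 Y \<le> m X * m Y" for X Y
    using m[of X] m[of Y] by (intro mult_mono) auto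
  have W: "?W = (\<Sum>X\<in>Pow I. split_gain (m0 X) (m X - m0 X))"
    using fibre_card_split[OF fin(1), of id I _ i]
    by (simp add: fibre_sum_insert[OF fin i] m_def m0_def F0_def)
  \<comment> \<open>An element is missing from the union exactly when it is missing from both sets;
    hence the products m0 X * m0 Y.\<close>
  have not_mem: "{t \<in> F \<times> F. i \<notin> ?U t} = F0 \<times> F0" by (auto simp: F0_def)
  have M0: "fibre_card {t \<in> F \<times> F. i \<notin> ?U t} ?U I Z = (\<Sum>p\<in>?P Z. m0 (fst p) * m0 (snd p))" for Z
    unfolding not_mem m0_def by (rule fibre_card_union[OF F0(1) fin(2)])
  have M1: "fibre_card {t \<in> F \<times> F. i \<in> ?U t} ?U I Z
      = (\<Sum>p\<in>?P Z. m (fst p) * m (snd p) - m0 (fst p) * m0 (snd p))" for Z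
    using fibre_card_split[OF F0(3), of ?U I Z i] fibre_card_union[OF fin, of Z]
    by (simp add: M0 sum_subtractf m_def)
  have V: "(\<Sum>p\<in>Pow I \<times> Pow I. split_gain (m0 (fst p) * m0 (snd p)) (m (fst p) * m (snd p) - m0 (fst p) * m0 (snd p))) \<le> ?V"
  proof -
    have "(\<Sum>p\<in>Pow I \<times> Pow I. split_gain (m0 (fst p) * m0 (snd p)) (m (fst p) * m (snd p) - m0 (fst p) * m0 (snd p)))
      = (\<Sum>Z\<in>Pow I. \<Sum>p\<in>?P Z. split_gain (m0 (fst p) * m0 (snd p)) (m (fst p) * m (snd p) - m0 (fst p) * m0 (snd p)))"
      using fin by (intro sum.group[symmetric]) auto
    also have "\<dots> \<le> (\<Sum>Z\<in>Pow I. split_gain (\<Sum>p\<in>?P Z. m0 (fst p) * m0 (snd p))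
        (\<Sum>p\<in>?P Z. m (fst p) * m (snd p) - m0 (fst p) * m0 (snd p)))"
      using fin m mm by (intro sum_mono sum_split_gain_le) auto
    also have "\<dots> = ?V"
      unfolding fibre_sum_insert[OF F0(3) fin(2) i] M0 M1 ..
    finally show ?thesis .
  qed
  have sum_m0: "(\<Sum>X\<in>Pow I. m0 X) = real (card F0)"
    unfolding m0_def by (rule sum_fibre_card[OF F0(1) fin(2)])
  let ?g = "\<lambda>X. split_gain (m0 X) (m X - m0 X)"
  have "(\<Sum>p\<in>Pow I \<times> Pow I. m0 (fst p) * ?g (snd p)) = real (card F0) * ?W"
    unfolding W sum_m0[symmetric] by (simp only: sum_product sum.cartesian_product split_def)
  moreover have "(\<Sum>p\<in>Pow I \<times> Pow I. ?g (fst p) * m0 (snd p)) = ?W * real (card F0)"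
    unfolding W sum_m0[symmetric] by (simp only: sum_product sum.cartesian_product split_def)
  \<comment> \<open>Adding the two orders of the pair gives the symmetric left side of
    \<open>split_gain_mult_ge\<close>, whence the factor 2.\<close>
  ultimately have "2 * (real (card F0) * ?W) =
      (\<Sum>p\<in>Pow I \<times> Pow I. m0 (fst p) * ?g (snd p) + m0 (snd p) * ?g (fst p))"
    by (simp add: sum.distrib mult.commute)
  also have "\<dots> \<le> (\<Sum>p\<in>Pow I \<times> Pow I. 2 * \<phi> * split_gain (m0 (fst p) * m0 (snd p)) (m (fst p) * m (snd p) - m0 (fst p) * m0 (snd p)))"
    using m by (intro sum_mono split_gain_mult_ge \<phi>) auto
  also have "\<dots> \<le> 2 * \<phi> * ?V"
    unfolding sum_distrib_left[symmetric] using V \<phi> by (intro mult_left_mono) (auto simp: S_def)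
  finally show ?thesis by (simp add: F0_def)
qed

text \<open>Telescoping \<open>fibre_sum_union_step\<close> over \<open>I\<close>; each entropy
  increment is nonnegative, so the varying count can be lowered to \<open>c\<close>.\<close>

lemma fibre_sum_union_ge:
  assumes \<phi>: "\<phi> \<in> S" "\<phi> < 1" and fin: "finite F" "finite I"
    and c: "\<And>i. i \<in> I \<Longrightarrow> c \<le> real (card {A \<in> F. i \<notin> A})"
  shows "c * (fibre_sum F id {} - fibre_sum F id I)
    \<le> \<phi> * (fibre_sum (F \<times> F) (\<lambda>(A, B). A \<union> B) {} - fibre_sum (F \<times> F) (\<lambda>(A, B). A \<union> B) I)"
  using fin(2) c
proof (induction I rule: finite_induct)
  case (insert i I)
  let ?W = "fibre_sum F id I - fibre_sum F id (insert i I)"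
  have "0 \<le> ?W"
    unfolding fibre_sum_insert[OF fin(1) insert.hyps] by (intro sum_nonneg split_gain_nonneg) auto
  then have "c * ?W \<le> real (card {A \<in> F. i \<notin> A}) * ?W"
    using insert.prems[of i] by (intro mult_right_mono) auto
  also note fibre_sum_union_step[OF \<phi> fin(1) insert.hyps]
  finally show ?case
    using insert.IH[OF insert.prems] insertI2 unfolding right_diff_distrib by fastforce
qed simp

section \<open>Entropy of the union against the uniform bound\<close>

theorem theorem1p2:
  fixes n :: nat and F :: "nat set set"
  assumes "n \<ge> 1"
    and "F \<subseteq> Pow {1..n}"
    and "union_closed F"
    and "F \<noteq> {}"
    and "F \<noteq> {{}}"
  shows "\<exists>i\<in>{1..n}. real (card {A \<in> F. i \<in> A}) \<ge> (1 - phi_star) * real (card F)"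
proof (rule ccontr)
  assume "\<not> ?thesis"
  then have few: "real (card {A \<in> F. i \<in> A}) < (1 - phi_star) * real (card F)" if "i \<in> {1..n}" for i
    using that by force
  have fin: "finite F" using assms(2) by (rule finite_subset) simp
  let ?U = "\<lambda>(A, B). A \<union> B :: nat set"
  let ?I = "{1..n}"
  define N where "N = real (card F)"
  have "0 < card F" using assms(4) fin by (simp add: card_gt_0_iff)
  have \<phi>: "phi_star \<in> S" "phi_star < 1" "0 < phi_star"
  proof -
    show "phi_star \<in> S" by (rule phi_star_in_S)
    then show "0 < phi_star" using golden_le_of_mem_S golden_pos by force
    have "0 < (1 - phi_star) * real (card F)"
      using few[of 1] assms(1) by (intro le_less_trans[OF of_nat_0_le_iff]) auto
    then show "phi_star < 1" by (simp add: zero_less_mult_iff)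
  qed
  \<comment> \<open>Two members are needed to make ln N positive, on which the final strict
    inequality rests.\<close>
  have "card F \<noteq> 1"
  proof
    assume "card F = 1"
    then obtain A where A: "F = {A}" by (auto simp: card_1_singleton_iff)
    then obtain i where "i \<in> A" "i \<in> {1..n}" using assms(2,5) by blast
    then have "1 < 1 - phi_star" using few[of i] A by (simp add: Collect_conv_if)
    then show False using \<phi> by simp
  qed
  then have N: "1 < N" using \<open>0 < card F\<close> by (simp add: N_def)
  define c where "c = Min ((\<lambda>i. real (card {A \<in> F. i \<notin> A})) ` ?I)"
  have c_le: "c \<le> real (card {A \<in> F. i \<notin> A})" if "i \<in> ?I" for i
    unfolding c_def using that by (intro Min_le) auto
  have c_gt: "phi_star * N < c"
  proof -
    have "phi_star * N < real (card {A \<in> F. i \<notin> A})" if "i \<in> ?I" for i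
    proof -
      have "{A \<in> F. i \<in> A} \<union> {A \<in> F. i \<notin> A} = F" by auto
      then have "card F = card {A \<in> F. i \<in> A} + card {A \<in> F. i \<notin> A}"
        using fin by (subst card_Un_disjoint[symmetric]) auto
      then show ?thesis using few[OF that] by (simp add: N_def algebra_simps)
    qed
    then show ?thesis unfolding c_def using assms(1) by (subst Min_gr_iff) auto
  qed
  have W0: "fibre_sum F id {} = N * ln N"
    by (simp add: fibre_sum_def fibre_card_def xlnx_def N_def)
  have V0: "fibre_sum (F \<times> F) ?U {} = 2 * N\<^sup>2 * ln N"
    using N by (simp add: fibre_sum_def fibre_card_def xlnx_def N_def card_cartesian_product ln_mult power2_eq_square)
  \<comment> \<open>Every member is its own trace on the ground set, so each fibre has size 0 or 1,
    where \<open>xlnx\<close> vanishes.\<close>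
  have Wn: "fibre_sum F id ?I = 0"
    unfolding fibre_sum_def
  proof (rule sum.neutral, rule ballI)
    fix X assume "X \<in> Pow ?I"
    have "A \<inter> ?I = A" if "A \<in> F" for A using that assms(2) by auto
    then have "{t \<in> F. id t \<inter> ?I = X} = (if X \<in> F then {X} else {})" by auto
    then show "xlnx (fibre_card F id ?I X) = 0" by (simp add: fibre_card_def)
  qed
  \<comment> \<open>Maximality of the uniform law: unions stay in \<open>F\<close>, so N^2 pairs
    fall on at most N values.\<close>
  have Vn: "N\<^sup>2 * ln N \<le> fibre_sum (F \<times> F) ?U ?I"
  proof -
    let ?r = "fibre_card (F \<times> F) ?U ?I"
    have zero: "?r Z = 0" if "Z \<notin> F" for Z
    proof -
      have "(A \<union> B) \<inter> ?I \<in> F" if "A \<in> F" "B \<in> F" for A B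
      proof -
        have "(A \<union> B) \<inter> ?I = A \<union> B" using that assms(2) by auto
        then show ?thesis using assms(3) that by (simp add: union_closed_def)
      qed
      then have "{t \<in> F \<times> F. ?U t \<inter> ?I = Z} = {}" using that by auto
      then show ?thesis by (simp only: fibre_card_def card.empty of_nat_0)
    qed
    have "(\<Sum>Z\<in>F. ?r Z) = (\<Sum>Z\<in>Pow ?I. ?r Z)"
      using assms(2) zero by (intro sum.mono_neutral_left) auto
    also have "\<dots> = N\<^sup>2"
      using fin by (simp add: sum_fibre_card card_cartesian_product N_def power2_eq_square)
    finally have total: "(\<Sum>Z\<in>F. ?r Z) = N\<^sup>2" .
    \<comment> \<open>Tangent lines at N, the average number of pairs per member of
      \<open>F\<close>; their linear corrections sum to zero.\<close>
    have "N\<^sup>2 * ln N = (\<Sum>Z\<in>F. ?r Z * ln N + ?r Z - N)"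
      by (simp only: sum.distrib sum_subtractf total sum_constant flip: sum_distrib_right) (simp add: N_def power2_eq_square)
    also have "\<dots> \<le> (\<Sum>Z\<in>F. xlnx (?r Z))"
      using N by (intro sum_mono xlnx_ge) auto
    also have "\<dots> = fibre_sum (F \<times> F) ?U ?I"
      unfolding fibre_sum_def using assms(2) zero by (intro sum.mono_neutral_left) auto
    finally show ?thesis .
  qed
  have "c * (N * ln N) \<le> phi_star * (2 * N\<^sup>2 * ln N - fibre_sum (F \<times> F) ?U ?I)"
    using fibre_sum_union_ge[OF \<phi>(1,2) fin, of ?I c] c_le unfolding W0 V0 Wn by simp
  also have "\<dots> \<le> phi_star * (N\<^sup>2 * ln N)"
  proof (rule mult_left_mono)
    show "2 * N\<^sup>2 * ln N - fibre_sum (F \<times> F) ?U ?I \<le> N\<^sup>2 * ln N" using Vn by linarith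
  qed (use \<phi>(3) in simp)
  also have "\<dots> = (phi_star * N) * (N * ln N)" by (simp add: power2_eq_square)
  also have "\<dots> < c * (N * ln N)"
    using c_gt N by (intro mult_strict_right_mono) auto
  finally show False by simp
qed

end
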